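(* Let $y_1<z_1<y_2<z_2<\cdots<y_n<z_n$ be real numbers, and suppose that the positive numbers $x_j=z_j-y_j$ ($1\le j\le n$) are strictly increasing in $j$. Put $Y=\{y_1,\dots,y_n\}$ and $Z=\{z_1,\dots,z_n\}$. Then for every nonempty $I\subseteq\{1,\dots,\lfloor n/2\rfloor-1\}$ there is $I'\subseteq I$ with $|I'|\ge|I|/2$ such that $$|2Y+2Z-2Y-Z|\ \ge\ \frac{n|I|}{4}\,\bigl|\{x_{j+1}-x_j:j\in I'\}\bigr|.$$
   Context: Here $2Y+2Z-2Y-Z=\{y+y'+z+z'-y''-y'''-z'':\ y,y',y'',y'''\in Y,\ z,z',z''\in Z\}$, i.e. $2Y=Y+Y$ and $2Z=Z+Z$ are sumsets, with all choices independent. *)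

theory Defs
  imports Complex_Main
begin

end

(* Squeezing: for i > n/2 the points y_i + x_j with j \<le> i lie in the interval (y_i, z_i], and these
   intervals are disjoint. If d is a consecutive difference with 0 < d \<le> x_(j+1) - x_j, then
   y_i + x_j + d lies between y_i + x_j and y_i + x_(j+1) and belongs to 2Y + 2Z - 2Y - Z.
   Split I at the median of the consecutive differences and let I' be the lower half: each of the at
   least |I|/2 indices j in the upper half admits every difference coming from I', and there are at
   least n/2 choices of i. *)

theory Submission
  imports Defs
begin

text \<open>Take \<open>t\<close> to be the least value of \<open>f\<close> for which at least half
  of \<open>I\<close> has \<open>f i \<le> t\<close>. The witnesses are the indices with value at
  most \<open>t\<close> and those with value at least \<open>t\<close>; ties at \<open>t\<close> go
  to both, so the two sets may overlap and each still contains half of \<open>I\<close>.\<close>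

lemma median_split:
  fixes f :: "'a \<Rightarrow> 'b::linorder"
  assumes "finite I"
  obtains A B where "A \<subseteq> I" "B \<subseteq> I" "card I \<le> 2 * card A" "card I \<le> 2 * card B"
    "\<And>a b. a \<in> A \<Longrightarrow> b \<in> B \<Longrightarrow> f a \<le> f b"
proof (cases "I = {}")
  case True
  then show ?thesis using that[of "{}" "{}"] by simp
next
  case False
  define L where "L t = {i \<in> I. f i \<le> t}" for t
  define T where "T = {t \<in> f ` I. card I \<le> 2 * card (L t)}"
  have "L (Max (f ` I)) = I"
    using assms by (auto simp: L_def)
  then have "Max (f ` I) \<in> T"
    using assms False by (simp add: T_def)
  moreover have finT: "finite T"
    using assms by (simp add: T_def)
  ultimately have T: "Min T \<in> T" by (metis Min_in empty_iff)
  define t where "t = Min T"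
  define B where "B = {i \<in> I. t \<le> f i}"
  define C where "C = {i \<in> I. f i < t}"
  have "2 * card C \<le> card I"
  proof (cases "C = {}")
    case False
    have finC: "finite C" using assms by (simp add: C_def)
    \<comment> \<open>As the largest value below \<open>t\<close>, \<open>s\<close> satisfies
      \<open>L s = C\<close>; minimality of \<open>t\<close> keeps \<open>s\<close> out of
      \<open>T\<close>, so \<open>C\<close> has less than half of the indices.\<close>
    define s where "s = Max (f ` C)"
    have "s \<in> f ` C" using finC False by (simp add: s_def)
    then have s: "s \<in> f ` I" "s < t" by (auto simp: C_def)
    have "L s = C"
    proof
      show "L s \<subseteq> C" using s(2) by (auto simp: L_def C_def)
      show "C \<subseteq> L s" using finC by (auto simp: L_def s_def) (simp add: C_def)
    qed
    moreover have "s \<notin> T"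
      using s(2) Min_le[OF finT, of s] unfolding t_def by (meson leD)
    ultimately show ?thesis using s(1) by (auto simp: T_def)
  qed simp
  moreover have "card I = card B + card C"
  proof -
    have "I = B \<union> C" "B \<inter> C = {}" by (auto simp: B_def C_def)
    then show ?thesis using assms by (metis card_Un_disjoint finite_Un)
  qed
  ultimately have "card I \<le> 2 * card B" by linarith
  moreover have "card I \<le> 2 * card (L t)" using T by (simp add: T_def t_def)
  ultimately show ?thesis
    using that[of "L t" B] by (fastforce simp: L_def B_def)
qed

text \<open>Used to read off an index from a point in a half-open interval
  \<open>(l i, r i]\<close>. Half-openness allows neighbours to share an endpoint, as the intervals
  between successive values of \<open>x\<close> do.\<close>

lemma consecutive_intervals_unique:
  fixes l r :: "'a::linorder \<Rightarrow> 'b::linorder"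
  assumes "\<And>i j. i \<in> A \<Longrightarrow> j \<in> A \<Longrightarrow> i < j \<Longrightarrow> r i \<le> l j"
    and "i \<in> A" "l i < w" "w \<le> r i" "j \<in> A" "l j < w" "w \<le> r j"
  shows "i = j"
proof (rule ccontr)
  assume "i \<noteq> j"
  then consider "i < j" | "j < i" by force
  then show False
    using assms by cases (meson leD less_le_trans le_less_trans)+
qed

lemma interlacing_less:
  fixes y z :: "nat \<Rightarrow> 'a::linorder"
  assumes yz: "\<And>j. j \<in> {1..n} \<Longrightarrow> y j < z j"
    and zy: "\<And>j. j \<in> {1..<n} \<Longrightarrow> z j < y (j + 1)"
    and "1 \<le> i" "i < k" "k \<le> n"
  shows "z i < y k"
  using \<open>i < k\<close> \<open>k \<le> n\<close>
proof (induction k)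
  case (Suc k)
  then consider "i = k" | "i < k" by linarith
  then show ?case
  proof cases
    case 2
    then have "z i < y k" "y k < z k" "z k < y (k + 1)"
      using Suc assms(3) yz[of k] zy[of k] by auto
    then show ?thesis by simp
  qed (use Suc.prems assms(3) zy[of k] in auto)
qed simp

theorem lemmaA1:
  fixes n :: nat and x y z :: "nat \<Rightarrow> real" and Y Z :: "real set" and I :: "nat set"
  assumes "\<And>j. j \<in> {1..n} \<Longrightarrow> y j < z j"
    and "\<And>j. j \<in> {1..<n} \<Longrightarrow> z j < y (j + 1)"
    and "\<And>j. j \<in> {1..n} \<Longrightarrow> x j = z j - y j"
    and "strict_mono_on {1..n} x"
    and "Y = y ` {1..n}"
    and "Z = z ` {1..n}"
    and "I \<noteq> {}"
    and "I \<subseteq> {1..n div 2 - 1}"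
  shows "\<exists>I'\<subseteq>I. real (card I') \<ge> real (card I) / 2 \<and>
    real (card {a + a' + b + b' - a'' - a''' - b'' | a a' a'' a''' b b' b''.
        a \<in> Y \<and> a' \<in> Y \<and> a'' \<in> Y \<and> a''' \<in> Y \<and> b \<in> Z \<and> b' \<in> Z \<and> b'' \<in> Z})
      \<ge> real n * real (card I) / 4 * real (card {x (j + 1) - x j | j. j \<in> I'})"
proof -
  let ?S = "{a + a' + b + b' - a'' - a''' - b'' | a a' a'' a''' b b' b''.
        a \<in> Y \<and> a' \<in> Y \<and> a'' \<in> Y \<and> a''' \<in> Y \<and> b \<in> Z \<and> b' \<in> Z \<and> b'' \<in> Z}"
  define S where "S = ?S"
  define d where "d j = x (j + 1) - x j" for j
  \<comment> \<open>Truncated subtraction is harmless here: an element \<open>j\<close> of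
    \<open>I\<close> forces \<open>n div 2\<close> to be at least 2.\<close>
  have Ibound: "1 \<le> j \<and> j + 1 \<le> n div 2 \<and> j < n" if "j \<in> I" for j
    using that assms(8) by force
  have mono: "x j \<le> x k" if "1 \<le> j" "j \<le> k" "k \<le> n" for j k
    using strict_mono_on_leD[OF assms(4)] that by auto
  have "finite I" using assms(8) finite_subset by blast
  then obtain A B where AB: "A \<subseteq> I" "B \<subseteq> I" "card I \<le> 2 * card A" "card I \<le> 2 * card B"
    "\<And>a b. a \<in> A \<Longrightarrow> b \<in> B \<Longrightarrow> d a \<le> d b"
    using median_split[of I d] by blast
  \<comment> \<open>Every \<open>i\<close> in \<open>H\<close> exceeds \<open>j + 1\<close> for all
    \<open>j\<close> in \<open>I\<close>, and \<open>H\<close> has \<open>n - n div 2\<close>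
    elements, at least half of \<open>n\<close> even when \<open>n\<close> is odd.\<close>
  define H where "H = {n div 2<..n}"
  \<comment> \<open>The last factor consists of difference values, not indices, so equal differences
    count once; otherwise \<open>g\<close> could not be injective.\<close>
  define P where "P = H \<times> B \<times> d ` A"
  define g where "g = (\<lambda>(i, j, e). y i + (x j + e))"
  have d_pos: "0 < d k" if "k \<in> A" for k
  proof -
    have "k \<in> {1..n}" "k + 1 \<in> {1..n}" using Ibound that AB(1) by force+
    then show ?thesis using strict_mono_onD[OF assms(4)] by (simp add: d_def)
  qed
  have in_x: "x j < x j + e \<and> x j + e \<le> x (j + 1)" if "j \<in> B" "e \<in> d ` A" for j e
    using that d_pos AB(5)[of _ j] by (force simp: d_def)
  have in_yz: "y i < y i + (x j + e) \<and> y i + (x j + e) \<le> z i"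
    if "i \<in> H" "j \<in> B" "e \<in> d ` A" for i j e
  proof -
    have j: "1 \<le> j" "j + 1 \<le> i" "i \<le> n" "1 \<le> i"
      using that Ibound[of j] AB(2) by (auto simp: H_def)
    then have "x (j + 1) \<le> x i" "0 < x j" "x i = z i - y i"
      using mono[of "j + 1" i] assms(1,3)[of j] assms(3)[of i] by auto
    then show ?thesis using in_x[OF that(2,3)] by linarith
  qed
  have "inj_on g P"
  proof (rule inj_onI)
    fix p q assume pq: "p \<in> P" "q \<in> P" "g p = g q"
    obtain i j e where p: "p = (i, j, e)" "i \<in> H" "j \<in> B" "e \<in> d ` A"
      using pq(1) by (auto simp: P_def)
    obtain i' j' e' where q: "q = (i', j', e')" "i' \<in> H" "j' \<in> B" "e' \<in> d ` A"
      using pq(2) by (auto simp: P_def)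
    have eq: "y i + (x j + e) = y i' + (x j' + e')"
      using pq(3) by (simp add: p q g_def)
    \<comment> \<open>The parameters are recovered in turn: \<open>i\<close> from the interval
      \<open>(y i, z i]\<close>, then, after cancelling \<open>y i\<close>, \<open>j\<close> from
      \<open>(x j, x (j + 1)]\<close>, and finally \<open>e\<close> by subtraction.\<close>
    have "i = i'"
    proof (rule consecutive_intervals_unique[where A = H and l = y and r = z])
      fix k l assume "k \<in> H" "l \<in> H" "k < l"
      then have "1 \<le> k" "l \<le> n" by (auto simp: H_def)
      then show "z k \<le> y l"
        using interlacing_less[of n y z k l] assms(1,2) \<open>k < l\<close> by force
    next
      show "y i < y i + (x j + e)" "y i + (x j + e) \<le> z i"
        using in_yz[OF p(2-4)] by auto
      show "y i' < y i + (x j + e)" "y i + (x j + e) \<le> z i'"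
        unfolding eq using in_yz[OF q(2-4)] by auto
    qed (fact p(2) q(2))+
    moreover from this eq have eq': "x j + e = x j' + e'" by simp
    have "j = j'"
    proof (rule consecutive_intervals_unique[where A = B and l = x and r = "\<lambda>j. x (j + 1)"])
      fix k l assume "k \<in> B" "l \<in> B" "k < l"
      then show "x (k + 1) \<le> x l"
        using mono[of "k + 1" l] Ibound[of l] AB(2) by force
    next
      show "x j < x j + e" "x j + e \<le> x (j + 1)"
        using in_x[OF p(3,4)] by auto
      show "x j' < x j + e" "x j + e \<le> x (j' + 1)"
        unfolding eq' using in_x[OF q(3,4)] by auto
    qed (fact p(3) q(3))+
    ultimately show "p = q" using eq by (simp add: p q)
  qed
  moreover have "g ` P \<subseteq> S"
  proof
    fix w assume "w \<in> g ` P"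
    then obtain i j k where w: "w = y i + (x j + d k)" "i \<in> H" "j \<in> B" "k \<in> A"
      by (auto simp: P_def g_def)
    have idx: "i \<in> {1..n}" "j \<in> {1..n}" "k \<in> {1..n}" "k + 1 \<in> {1..n}"
      using w Ibound[of j] Ibound[of k] AB(1,2) by (auto simp: H_def)
    \<comment> \<open>Expanding \<open>x j\<close>, \<open>x (k + 1)\<close> and \<open>x k\<close>
      as differences of \<open>z\<close> and \<open>y\<close> gives exactly two plus and two minus
      terms from \<open>Y\<close>, and two plus and one minus from \<open>Z\<close>.\<close>
    then have eq: "w = y i + y k + z j + z (k + 1) - y j - y (k + 1) - z k"
      using w(1) assms(3) by (simp add: d_def)
    show "w \<in> S" unfolding S_def assms(5,6)
      by (intro CollectI exI conjI, rule eq) (intro imageI idx)+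
  qed
  \<comment> \<open>Without finiteness \<open>card S\<close> would default to 0 and the inclusion
    would give no lower bound.\<close>
  moreover have "finite S"
  proof -
    let ?h = "\<lambda>(a, a', a'', a''', b, b', b''). a + a' + b + b' - a'' - a''' - b''"
    have "S \<subseteq> ?h ` (Y \<times> Y \<times> Y \<times> Y \<times> Z \<times> Z \<times> Z)"
    proof
      fix w assume "w \<in> S"
      then obtain a a' a'' a''' b b' b'' where w: "w = a + a' + b + b' - a'' - a''' - b''"
        "a \<in> Y" "a' \<in> Y" "a'' \<in> Y" "a''' \<in> Y" "b \<in> Z" "b' \<in> Z" "b'' \<in> Z" unfolding S_def by blast
      show "w \<in> ?h ` (Y \<times> Y \<times> Y \<times> Y \<times> Z \<times> Z \<times> Z)"
        by (rule image_eqI[where x = "(a, a', a'', a''', b, b', b'')"]) (simp_all add: w)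
    qed
    moreover have "finite (?h ` (Y \<times> Y \<times> Y \<times> Y \<times> Z \<times> Z \<times> Z))"
      by (intro finite_imageI finite_cartesian_product) (simp_all add: assms(5,6))
    ultimately show ?thesis by (rule finite_subset)
  qed
  ultimately have "card P \<le> card S" by (simp only: card_image[symmetric] card_mono)
  moreover have "card P = card H * card B * card (d ` A)"
    by (simp add: P_def card_cartesian_product)
  \<comment> \<open>The constant 1/4 is the product of two halvings: \<open>H\<close> against
    \<open>n\<close>, and \<open>B\<close> against \<open>I\<close>. The size of \<open>A\<close>
    enters only through the requirement on \<open>I'\<close>.\<close>
  moreover have "real n / 2 * (real (card I) / 2) * real (card (d ` A))
      \<le> real (card H) * real (card B) * real (card (d ` A))"
  proof (intro mult_right_mono mult_mono)
    have "n \<le> 2 * card H" by (simp add: H_def)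
    then show "real n / 2 \<le> real (card H)" by linarith
    show "real (card I) / 2 \<le> real (card B)" using AB(4) by linarith
  qed auto
  ultimately have "real n * real (card I) / 4 * real (card (d ` A)) \<le> real (card S)"
    by (simp flip: of_nat_mult)
  moreover have "d ` A = {x (j + 1) - x j | j. j \<in> A}" by (auto simp: d_def)
  moreover have "real (card I) / 2 \<le> real (card A)" using AB(3) by linarith
  ultimately show ?thesis using AB(1) unfolding S_def by (intro exI[of _ A]) simp
qed

end
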